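(* Let $R_c\in(0,\tfrac12]$, and let $f_s,f_l$ be any force coefficients as in the context, where the total force is purely repulsive along $s=(0,1)$ on $[0,R_c)$, i.e. $f_s>0$ on $[0,R_c)$. Then, for $N\in\mathbb N$ sufficiently large and in the continuum limit $N\to\infty$, the single horizontal straight line $$\bar x_k=\Big(\frac kN,0\Big),\qquad k=1,\dots,N,$$ is an unstable steady state of the particle model $$\frac{\mathrm d x_j}{\mathrm d t}=\frac1N\sum_{k\ne j}\bar F(x_j-x_k),\qquad j=1,\dots,N .$$
   Context: Force: $f_l,f_s:[0,\infty)\to\mathbb R$ are continuously differentiable and vanish on $[R_c,\infty)$, where $R_c\in(0,\frac12]$ is the cutoff radius; $f_s\ge 0$; $f_l$ is short-range repulsive and long-range attractive (positive for small distances, negative for larger distances below the cutoff), with $f_l(R_c)=0$. Put $F(d)=(f_l(|d|)d_1,\ f_s(|d|)d_2)$ for $d=(d_1,d_2)\in[-\frac12,\frac12]^2$, and let $\bar F:\mathbb R^2\to\mathbb R^2$ be the $\mathbb Z^2$-periodic extension of $F$. A steady state is a configuration $(\bar x_j)$ with $\sum_{k\neq j}\bar F(\bar x_j-\bar x_k)=0$ for all $j$. Stability matrix: for a steady state $(\bar x_j)_{j=1}^N$, $M_N(j,m)\in\mathbb C^{2\times2}$ is the matrix with columns $$I_i(j,m)=\frac1N\sum_{k\ne j}\Big(1-e^{2\pi i m(k-j)/N}\Big)\frac{\partial\bar F}{\partial d_i}(\bar x_j-\bar x_k),\quad i=1,2$$ (the $i$ in the exponent is the imaginary unit). It governs the linearised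 evolution of perturbations $\bar x_j+(\zeta_g,\zeta_h)\,(e^{2\pi i mj/N}+e^{-2\pi i mj/N})$ through $\frac{\mathrm d}{\mathrm dt}(\zeta_g,\zeta_h)^T=M_N(j,m)(\zeta_g,\zeta_h)^T$. For straight lines $M_N(j,m)$ does not depend on $j$; write $M(m)=\lim_{N\to\infty}M_N(j,m)$ for fixed $m\in\mathbb N=\{1,2,\dots\}$. Instability (linear): the line is unstable in the continuum limit if $M(m)$ has an eigenvalue with positive real part for some $m\in\mathbb N$. It is unstable for $N$ sufficiently large if there is $N_0$ such that for every $N\ge N_0$ there is $m\in\{1,\dots,N-1\}$ for which $M_N(j,m)$ has an eigenvalue with positive real part. *)

theory Defs
  imports "HOL-Analysis.Analysis"
begin

text \<open>Continuous differentiability on \<open>[0,\<infinity>)\<close>, with the one-sided derivative at \<open>0\<close>.\<close>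

definition C1_on_nonneg :: "(real \<Rightarrow> real) \<Rightarrow> bool" where
  "C1_on_nonneg f \<longleftrightarrow>
     (\<exists>f'. (\<forall>r\<ge>0. (f has_real_derivative f' r) (at r within {0..})) \<and> continuous_on {0..} f')"

text \<open>\<open>f\<close> is positive for small distances and negative for larger distances below the cutoff.
  The two thresholds need not coincide (no sign is prescribed between them), and no sign is
  prescribed at distance \<open>0\<close>; a single crossover is the case \<open>a = b\<close>.\<close>

definition short_repulsive_long_attractive :: "real \<Rightarrow> (real \<Rightarrow> real) \<Rightarrow> bool" where
  "short_repulsive_long_attractive Rc f \<longleftrightarrow>
     (\<exists>a b. 0 < a \<and> a \<le> b \<and> b < Rc \<and> (\<forall>r. 0 < r \<and> r < a \<longrightarrow> 0 < f r)
        \<and> (\<forall>r. b < r \<and> r < Rc \<longrightarrow> f r < 0))"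

text \<open>The coefficients are total functions on the reals, but only their values on
  \<open>[0,\<infinity>)\<close> are constrained or used.\<close>

definition force_coefficients ::
    "real \<Rightarrow> (real \<Rightarrow> real) \<Rightarrow> (real \<Rightarrow> real) \<Rightarrow> bool" where
  "force_coefficients Rc fl fs \<longleftrightarrow>
     C1_on_nonneg fl \<and> C1_on_nonneg fs
     \<and> (\<forall>r\<ge>Rc. fl r = 0) \<and> (\<forall>r\<ge>Rc. fs r = 0)
     \<and> (\<forall>r\<ge>0. 0 \<le> fs r)
     \<and> short_repulsive_long_attractive Rc fl"

definition force :: "(real \<Rightarrow> real) \<Rightarrow> (real \<Rightarrow> real) \<Rightarrow> real^2 \<Rightarrow> real^2" where
  "force fl fs d = vector [fl (norm d) * d$1, fs (norm d) * d$2]"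

text \<open>The periodic extension evaluates the force at the representative of \<open>d\<close> modulo the integer
  lattice in \<open>[-1/2,1/2) \<times> [-1/2,1/2)\<close>. On the boundary of the unit cell the force vanishes since
  the cutoff is at most \<open>1/2\<close>, so the choice of representative there is immaterial
  (\<open>periodic_force_eq_force\<close> below).\<close>

definition periodic_force :: "(real \<Rightarrow> real) \<Rightarrow> (real \<Rightarrow> real) \<Rightarrow> real^2 \<Rightarrow> real^2" where
  "periodic_force fl fs d = force fl fs (\<chi> i. d$i - of_int (round (d$i)))"

lemma periodic_force_periodic:
  assumes "\<And>i. z$i \<in> \<int>"
  shows "periodic_force fl fs (d + z) = periodic_force fl fs d"
proof -
  have "(d + z)$i - of_int (round ((d + z)$i)) = d$i - of_int (round (d$i))" for i
  proof -
    obtain n where n: "z$i = of_int n" using assms[of i] by (auto elim: Ints_cases)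
    have "d$i + of_int n + 1/2 = (d$i + 1/2) + of_int n" by simp
    then have "round (d$i + of_int n) = round (d$i) + n"
      unfolding round_def by (metis floor_add_int)
    then show ?thesis by (simp add: n)
  qed
  then show ?thesis by (simp only: periodic_force_def)
qed

lemma periodic_force_eq_force:
  assumes "Rc \<le> 1/2" "\<And>r. r \<ge> Rc \<Longrightarrow> fl r = 0" "\<And>r. r \<ge> Rc \<Longrightarrow> fs r = 0"
    and d: "\<And>i. \<bar>d$i\<bar> \<le> 1/2"
  shows "periodic_force fl fs d = force fl fs d"
proof (cases "\<exists>i. d$i = 1/2")
  case True
  then obtain i where i: "d$i = 1/2" by blast
  define e where "e = (\<chi> i. d$i - of_int (round (d$i)))"
  have "\<bar>d$i\<bar> \<le> norm d" "\<bar>e$i\<bar> \<le> norm e" by (rule component_le_norm_cart)+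
  moreover have "\<bar>e$i\<bar> = 1/2" by (simp add: e_def i round_def)
  ultimately have "norm d \<ge> Rc" "norm e \<ge> Rc" using assms(1) i by auto
  then show ?thesis
    using assms(2,3) by (simp add: periodic_force_def force_def flip: e_def)
next
  case False
  have "round (d$i) = 0" for i
  proof -
    have "d$i \<noteq> 1/2" "\<bar>d$i\<bar> \<le> 1/2" using False d by blast+
    then have "0 \<le> d$i + 1/2" "d$i + 1/2 < 1" by linarith+
    then show ?thesis unfolding round_def by (simp add: floor_eq_iff)
  qed
  then show ?thesis by (simp add: periodic_force_def)
qed

text \<open>A configuration of \<open>N\<close> particles is a function on indices, of which only the values
  on \<open>{1..N}\<close> matter.\<close>

definition steady_state :: "(real^2 \<Rightarrow> real^2) \<Rightarrow> nat \<Rightarrow> (nat \<Rightarrow> real^2) \<Rightarrow> bool" where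
  "steady_state G N x \<longleftrightarrow> (\<forall>j\<in>{1..N}. (\<Sum>k\<in>{1..N} - {j}. G (x j - x k)) = 0)"

definition partial_deriv :: "(real^2 \<Rightarrow> real^2) \<Rightarrow> 2 \<Rightarrow> real^2 \<Rightarrow> real^2" where
  "partial_deriv G i d = vector_derivative (\<lambda>t. G (d + t *\<^sub>R axis i 1)) (at 0)"

definition stability_column ::
    "(real^2 \<Rightarrow> real^2) \<Rightarrow> nat \<Rightarrow> (nat \<Rightarrow> real^2) \<Rightarrow> nat \<Rightarrow> nat \<Rightarrow> 2 \<Rightarrow> complex^2" where
  "stability_column G N x j m i = (\<chi> r. (1 / of_nat N) *
     (\<Sum>k\<in>{1..N} - {j}.
        (1 - exp (2 * of_real pi * \<i> * of_nat m * (of_nat k - of_nat j) / of_nat N))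
        * of_real (partial_deriv G i (x j - x k) $ r)))"

definition stability_matrix ::
    "(real^2 \<Rightarrow> real^2) \<Rightarrow> nat \<Rightarrow> (nat \<Rightarrow> real^2) \<Rightarrow> nat \<Rightarrow> nat \<Rightarrow> complex^2^2" where
  "stability_matrix G N x j m = (\<chi> r i. stability_column G N x j m i $ r)"

definition eigenvalue :: "complex^'n^'n \<Rightarrow> complex \<Rightarrow> bool" where
  "eigenvalue A \<mu> \<longleftrightarrow> (\<exists>v. v \<noteq> 0 \<and> A *v v = \<mu> *s v)"

definition has_unstable_eigenvalue :: "complex^'n^'n \<Rightarrow> bool" where
  "has_unstable_eigenvalue A \<longleftrightarrow> (\<exists>\<mu>. eigenvalue A \<mu> \<and> 0 < Re \<mu>)"

text \<open>In the next two definitions \<open>x N\<close> is the configuration of \<open>N\<close> particles. They are meant for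
  straight lines, whose stability matrices do not depend on the particle \<open>j\<close>; the condition
  (respectively the limit, whose existence is part of the definition) is required for every \<open>j\<close>,
  with the frequency \<open>m\<close> independent of \<open>j\<close>.\<close>

definition unstable_for_large_N ::
    "(real^2 \<Rightarrow> real^2) \<Rightarrow> (nat \<Rightarrow> nat \<Rightarrow> real^2) \<Rightarrow> bool" where
  "unstable_for_large_N G x \<longleftrightarrow>
     (\<exists>N0. \<forall>N\<ge>N0. \<exists>m\<in>{1..<N}. \<forall>j\<in>{1..N}. has_unstable_eigenvalue (stability_matrix G N (x N) j m))"

definition unstable_in_continuum_limit ::
    "(real^2 \<Rightarrow> real^2) \<Rightarrow> (nat \<Rightarrow> nat \<Rightarrow> real^2) \<Rightarrow> bool" where
  "unstable_in_continuum_limit G x \<longleftrightarrow>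
     (\<exists>M. (\<forall>m\<ge>1. \<forall>j\<ge>1. (\<lambda>N. stability_matrix G N (x N) j m) \<longlonglongrightarrow> M m)
        \<and> (\<exists>m\<ge>1. has_unstable_eigenvalue (M m)))"

definition horizontal_line :: "nat \<Rightarrow> nat \<Rightarrow> real^2" where
  "horizontal_line N k = vector [real k / real N, 0]"

end

theory Submission
  imports Defs
begin

text \<open>On the horizontal line all displacements are of the form \<open>(p, 0)\<close>, where the Jacobian of the
  periodic force is diagonal, with second diagonal entry \<open>fs\<close> evaluated at the distance of \<open>p\<close> to
  the nearest integer. So the stability matrix is diagonal, and the real part of its second
  eigenvalue averages \<open>(1 - cos (2 * pi * m * s)) * fs (min s (1 - s))\<close> over the grid points
  \<open>s = k / N\<close>. For \<open>m = 1\<close> these terms are nonnegative, and positive for \<open>0 < s < Rc\<close>. In the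
  limit the averages are Riemann sums of a continuous function.\<close>

section \<open>Riemann sums and sums over a full period\<close>

lemma riemann_sum_tendsto_integral:
  fixes h :: "real \<Rightarrow> 'a::banach"
  assumes "continuous_on {0..1} h"
  shows "(\<lambda>N. (1 / real N) *\<^sub>R (\<Sum>k=1..N. h (real k / real N))) \<longlonglongrightarrow> integral {0..1} h"
proof (rule LIMSEQ_I)
  fix e :: real assume "0 < e"
  have "uniformly_continuous_on {0..1} h"
    using assms by (intro compact_uniformly_continuous) auto
  then obtain d where "0 < d" and d: "\<And>s t. s \<in> {0..1} \<Longrightarrow> t \<in> {0..1} \<Longrightarrow> dist s t < d \<Longrightarrow> dist (h s) (h t) < e/2"
    using \<open>0 < e\<close> by (metis uniformly_continuous_on_def half_gt_zero)
  obtain N0 :: nat where N0: "1 / d < real N0" using reals_Archimedean2 by blast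
  have int: "h integrable_on {a..b}" if "0 \<le> a" "b \<le> 1" for a b
    using that assms by (intro integrable_continuous_interval) (auto elim: continuous_on_subset)
  have "norm ((1 / real N) *\<^sub>R (\<Sum>k=1..N. h (real k / real N)) - integral {0..1} h) < e"
    if N: "N \<ge> Suc N0" for N
  proof -
    let ?t = "\<lambda>k. real k / real N"
    have Npos: "0 < real N" using N by simp
    have "1 / d < real N" using N N0 by linarith
    then have Nd: "1 / real N < d" using \<open>0 < d\<close> Npos by (simp add: field_simps)
    \<comment> \<open>The right-endpoint rule is compared with the integral cell by cell. Uniform
      continuity bounds the error on each cell by \<open>e/2\<close> times its length, and
      \<open>e/2\<close> leaves room for the strict inequality at the end.\<close>
    have split: "integral {0..?t n} h = (\<Sum>k=1..n. integral {?t (k-1)..?t k} h)" if "n \<le> N" for n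
      using that
    proof (induction n)
      case (Suc n)
      have "integral {0..?t n} h + integral {?t n..?t (Suc n)} h = integral {0..?t (Suc n)} h"
        using Suc.prems Npos by (intro Henstock_Kurzweil_Integration.integral_combine int) (auto simp: divide_simps)
      then show ?case using Suc by simp
    qed simp
    have step: "norm ((1 / real N) *\<^sub>R h (?t k) - integral {?t (k-1)..?t k} h) \<le> e/2 * (1 / real N)"
      if k: "k \<in> {1..N}" for k
    proof -
      have le: "?t (k-1) \<le> ?t k" and bds: "0 \<le> ?t (k-1)" "?t k \<le> 1" and len: "?t k - ?t (k-1) = 1 / real N"
        using k Npos by (auto simp: divide_simps of_nat_diff)
      have "((\<lambda>s. h (?t k) - h s) has_integral
          (1 / real N) *\<^sub>R h (?t k) - integral {?t (k-1)..?t k} h) {?t (k-1)..?t k}"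
        using has_integral_const_real[of "h (?t k)" "?t (k-1)" "?t k"] int[OF bds] le len
        by (intro has_integral_diff) (auto simp: has_integral_integral)
      moreover have "norm (h (?t k) - h s) \<le> e/2" if "s \<in> {?t (k-1)..?t k}" for s
      proof -
        have "s \<in> {0..1}" "dist (?t k) s < d"
          using that bds len Nd unfolding dist_real_def atLeastAtMost_iff by linarith+
        moreover have "?t k \<in> {0..1}" using bds le unfolding atLeastAtMost_iff by linarith
        ultimately show ?thesis using d[of "?t k" s] by (simp add: dist_norm)
      qed
      ultimately have "norm ((1 / real N) *\<^sub>R h (?t k) - integral {?t (k-1)..?t k} h)
          \<le> e/2 * Henstock_Kurzweil_Integration.content {?t (k-1)..?t k}"
        using \<open>0 < e\<close> by (intro has_integral_bound_real[of _ "{}"]) auto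
      then show ?thesis using le len by simp
    qed
    have "norm ((1 / real N) *\<^sub>R (\<Sum>k=1..N. h (?t k)) - integral {0..1} h)
        = norm (\<Sum>k=1..N. (1 / real N) *\<^sub>R h (?t k) - integral {?t (k-1)..?t k} h)"
      using split[of N] Npos by (simp add: scaleR_sum_right sum_subtractf)
    also have "\<dots> \<le> (\<Sum>k=1..N. e/2 * (1 / real N))"
      by (intro order_trans[OF norm_sum] sum_mono step)
    also have "\<dots> < e" using Npos \<open>0 < e\<close> by simp
    finally show ?thesis .
  qed
  then show "\<exists>no. \<forall>n\<ge>no. norm ((1 / real n) *\<^sub>R (\<Sum>k=1..n. h (real k / real n)) - integral {0..1} h) < e"
    by blast
qed

text \<open>Moving the window of summation by one position telescopes to
  \<open>g (- j) - g (N - j)\<close>, which periodicity cancels. This removes the particle index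
  \<open>j\<close> from sums over \<open>k - j\<close>.\<close>

lemma sum_periodic_shift:
  fixes g :: "int \<Rightarrow> 'a::ab_group_add"
  assumes "\<And>i. g (i + int N) = g i"
  shows "(\<Sum>k=1..N. g (int k - int j)) = (\<Sum>k=1..N. g (int k))"
proof (induction j)
  case (Suc j)
  have "(\<Sum>k=1..N. g (int k - int (Suc j))) - (\<Sum>k=1..N. g (int k - int j))
      = (\<Sum>k=1..N. g (int k - 1 - int j) - g (int k - int j))"
    by (simp add: sum_subtractf algebra_simps)
  also have "\<dots> = g (- int j) - g (int N - int j)"
    by (induction N) (auto simp: algebra_simps)
  also have "\<dots> = 0" using assms[of "- int j"] by (simp add: algebra_simps)
  finally show ?case using Suc by simp
qed simp

section \<open>Derivatives of the periodic force at points of the horizontal axis\<close>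

lemma has_vector_derivative_vector_2:
  fixes u v :: "real \<Rightarrow> real"
  assumes "(u has_real_derivative a) (at x within S)" "(v has_real_derivative b) (at x within S)"
  shows "((\<lambda>t. vector [u t, v t] :: real^2) has_vector_derivative vector [a, b]) (at x within S)"
proof -
  have eq: "(vector [x, y] :: real^2) = x *\<^sub>R axis 1 1 + y *\<^sub>R axis 2 1" for x y
    by (simp add: vec_eq_iff forall_2 axis_def)
  show ?thesis unfolding eq using assms
    by (intro has_vector_derivative_add has_vector_derivative_scaleR[OF _ has_vector_derivative_const, simplified])
qed

lemma norm_vector_2: "norm (vector [a, b] :: real^2) = sqrt (a\<^sup>2 + b\<^sup>2)"
  by (simp add: norm_vec_def L2_set_def sum_2)

text \<open>The derivative is already determined by the values to the right of \<open>r\<close>,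
  where \<open>f\<close> is zero. This is used at distances of at least 1/2, in particular at 1/2
  itself, where the periodic wrap jumps.\<close>

lemma has_real_derivative_zero_of_vanishing:
  assumes "(f has_real_derivative D) (at r within {0..})" "0 \<le> r" "\<And>s. s \<ge> r \<Longrightarrow> f s = 0"
  shows "D = 0"
proof -
  have D: "(f has_real_derivative D) (at r within {r..})"
    by (rule has_field_derivative_subset[OF assms(1)]) (use assms(2) in auto)
  have "(f has_real_derivative 0) (at r within {r..})"
    by (rule has_field_derivative_transform_within[OF DERIV_const zero_less_one]) (use assms(3) in auto)
  with D have "(f has_real_derivative D) (at_right r)" "(f has_real_derivative 0) (at_right r)"
    by (auto elim: has_field_derivative_subset)
  then show ?thesis
    using vector_derivative_unique_within[of r "{r<..}" f D 0] trivial_limit_at_right_real[of r]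
    by (simp add: has_real_derivative_iff_has_vector_derivative)
qed

text \<open>Away from 0 the absolute value of \<open>q\<close> is interior to \<open>{0..}\<close>,
  so the one-sided derivative of \<open>f\<close> is two-sided there and the chain rule applies;
  \<open>sgn q * q\<close> then gives the absolute value.\<close>

lemma odd_force_has_derivative:
  fixes f :: "real \<Rightarrow> real"
  assumes "(f has_real_derivative D) (at \<bar>q\<bar> within {0..})" "q \<noteq> 0"
  shows "((\<lambda>r. f \<bar>r\<bar> * r) has_real_derivative D * \<bar>q\<bar> + f \<bar>q\<bar>) (at q)"
proof -
  have "(f has_real_derivative D) (at \<bar>q\<bar>)"
    using assms at_within_interior[of "\<bar>q\<bar>" "{0..}"] by simp
  moreover have "(abs has_real_derivative sgn q) (at q)"
  proof (rule has_field_derivative_transform_within)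
    show "((*) (sgn q) has_real_derivative sgn q) (at q)"
      using DERIV_cmult_Id .
    show "0 < \<bar>q\<bar>" using assms(2) by simp
  qed (auto simp: dist_real_def sgn_if abs_if split: if_splits)
  ultimately have "((\<lambda>r. f \<bar>r\<bar>) has_real_derivative D * sgn q) (at q)"
    by (rule DERIV_chain2)
  from DERIV_mult[OF this DERIV_ident] have "((\<lambda>r. f \<bar>r\<bar> * r) has_real_derivative D * sgn q * q + 1 * f \<bar>q\<bar>) (at q)" .
  moreover have "D * sgn q * q + 1 * f \<bar>q\<bar> = D * \<bar>q\<bar> + f \<bar>q\<bar>" by (simp add: sgn_if abs_if)
  ultimately show ?thesis by (rule DERIV_cong)
qed

text \<open>Writing the periodic wrap as a sum of three translates avoids one-sided derivatives at the
  boundary of the unit cell, where \<open>round\<close> jumps.\<close>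

lemma wrap_eq_sum:
  fixes \<theta> :: "real \<Rightarrow> real"
  assumes "\<And>r. 1/2 \<le> \<bar>r\<bar> \<Longrightarrow> \<theta> r = 0" "\<bar>u\<bar> \<le> 1"
  shows "\<theta> (u - of_int (round u)) = \<theta> u + \<theta> (u + 1) + \<theta> (u - 1)"
proof -
  consider "u < -1/2" | "-1/2 \<le> u" "u < 1/2" | "1/2 \<le> u" by linarith
  then show ?thesis
  proof cases
    case 1
    then have "round u = -1" using assms(2) unfolding round_def by (intro floor_unique) auto
    then show ?thesis using 1 assms(1)[of u] assms(1)[of "u-1"] by simp
  next
    case 2
    then have "round u = 0" unfolding round_def by (intro floor_unique) auto
    then show ?thesis using 2 assms(1)[of "u+1"] assms(1)[of "u-1"] by simp
  next
    case 3
    then have "round u = 1" using assms(2) unfolding round_def by (intro floor_unique) auto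
    then show ?thesis using 3 assms(1)[of u] assms(1)[of "u+1"] by simp
  qed
qed

text \<open>The minus sign comes from x_j - x_k = -(k - j)/N. The tie s = 1/2 belongs to the first
  case because \<open>round\<close> rounds halves upwards, so
  \<open>round (-1/2) = 0\<close>.\<close>

lemma abs_minus_round_uminus:
  fixes s :: real
  assumes "0 \<le> s" "s \<le> 1"
  shows "\<bar>- s - of_int (round (- s))\<bar> = min s (1 - s)"
proof (cases "s \<le> 1/2")
  case True
  then have "round (- s) = 0" using assms unfolding round_def by (intro floor_unique) auto
  then show ?thesis using True assms by simp
next
  case False
  then have "round (- s) = -1" using assms unfolding round_def by (intro floor_unique) auto
  then show ?thesis using False assms by simp
qed

lemma minus_round_add_int: "(x + of_int n) - of_int (round (x + of_int n)) = x - of_int (round (x::real))"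
proof -
  have "x + of_int n + 1/2 = (x + 1/2) + of_int n" by simp
  then have "round (x + of_int n) = round x + n"
    unfolding round_def by (metis floor_add_int)
  then show ?thesis by simp
qed

lemma periodic_force_vector_2:
  "periodic_force fl fs (vector [p, t]) =
    force fl fs (vector [p - of_int (round p), t - of_int (round t)])"
  unfolding periodic_force_def
  by (rule arg_cong[where f = "force fl fs"]) (simp add: vec_eq_iff forall_2)

lemma periodic_force_axis:
  "periodic_force fl fs (vector [p, 0]) =
    vector [fl \<bar>p - of_int (round p)\<bar> * (p - of_int (round p)), 0]"
  by (simp add: periodic_force_vector_2 force_def norm_vector_2)

lemma horizontal_line_diff:
  "horizontal_line N j - horizontal_line N k = vector [(real j - real k) / real N, 0]"
  by (simp add: horizontal_line_def vec_eq_iff forall_2 diff_divide_distrib)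

text \<open>The displacement moves perpendicular to the line, so the wrap of the first coordinate
  stays fixed and the distance is stationary to first order. Hence \<open>Dl\<close> and
  \<open>Ds\<close> drop out and only the product rule term with \<open>fs\<close> survives.\<close>

lemma partial_deriv_periodic_force_2:
  fixes p :: real
  defines "q \<equiv> p - of_int (round p)"
  assumes "(fl has_real_derivative Dl) (at \<bar>q\<bar> within {0..})"
    and "(fs has_real_derivative Ds) (at \<bar>q\<bar> within {0..})" and "q \<noteq> 0"
  shows "partial_deriv (periodic_force fl fs) 2 (vector [p, 0]) = vector [0, fs \<bar>q\<bar>]"
  unfolding partial_deriv_def
proof (rule vector_derivative_at)
  have at: "(fl has_real_derivative Dl) (at (sqrt (q\<^sup>2 + 0\<^sup>2)))" "(fs has_real_derivative Ds) (at (sqrt (q\<^sup>2 + 0\<^sup>2)))"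
    using assms at_within_interior[of "\<bar>q\<bar>" "{0..}"] by simp_all
  have sq: "((\<lambda>t. sqrt (q\<^sup>2 + t\<^sup>2)) has_real_derivative 0) (at 0)"
    using \<open>q \<noteq> 0\<close> by (auto intro!: derivative_eq_intros)
  have "((\<lambda>t. vector [fl (sqrt (q\<^sup>2 + t\<^sup>2)) * q, fs (sqrt (q\<^sup>2 + t\<^sup>2)) * t] :: real^2)
      has_vector_derivative vector [0, fs \<bar>q\<bar>]) (at 0)"
  proof (rule has_vector_derivative_vector_2)
    show "((\<lambda>t. fl (sqrt (q\<^sup>2 + t\<^sup>2)) * q) has_real_derivative 0) (at 0)"
      using DERIV_cmult_right[OF DERIV_chain2[OF at(1) sq], of q] by simp
    show "((\<lambda>t. fs (sqrt (q\<^sup>2 + t\<^sup>2)) * t) has_real_derivative fs \<bar>q\<bar>) (at 0)"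
      using DERIV_mult[OF DERIV_chain2[OF at(2) sq] DERIV_ident] by simp
  qed
  then show "((\<lambda>t. periodic_force fl fs (vector [p, 0] + t *\<^sub>R axis 2 1))
      has_vector_derivative vector [0, fs \<bar>q\<bar>]) (at 0)"
  proof (rule has_vector_derivative_transform_within_open[of _ _ _ "{-1/2<..<1/2}"])
    fix t :: real assume t: "t \<in> {-1/2<..<1/2}"
    then have "round t = 0" unfolding round_def by (intro floor_unique) auto
    moreover have "vector [p, 0] + t *\<^sub>R axis 2 1 = (vector [p, t] :: real^2)"
      by (simp add: vec_eq_iff forall_2 axis_def)
    ultimately show "vector [fl (sqrt (q\<^sup>2 + t\<^sup>2)) * q, fs (sqrt (q\<^sup>2 + t\<^sup>2)) * t]
        = periodic_force fl fs (vector [p, 0] + t *\<^sub>R axis 2 1)"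
      by (simp add: periodic_force_vector_2 force_def norm_vector_2 q_def)
  qed auto
qed

text \<open>Here the wrapped coordinate itself moves, and at q = -1/2 it jumps. The form with three
  translates is differentiable term by term: q + 1 and q - 1 have absolute value at least 1/2, so
  they contribute derivative 0.\<close>

lemma partial_deriv_periodic_force_1:
  fixes p :: real
  defines "q \<equiv> p - of_int (round p)"
  assumes deriv: "\<And>r. 0 \<le> r \<Longrightarrow> (fl has_real_derivative fl' r) (at r within {0..})"
    and vanish: "\<And>r. 1/2 \<le> r \<Longrightarrow> fl r = 0" and "q \<noteq> 0"
  shows "partial_deriv (periodic_force fl fs) 1 (vector [p, 0]) = vector [fl' \<bar>q\<bar> * \<bar>q\<bar> + fl \<bar>q\<bar>, 0]"
  unfolding partial_deriv_def
proof (rule vector_derivative_at)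
  define \<theta> where "\<theta> r = fl \<bar>r\<bar> * r" for r
  have \<theta>0: "\<theta> r = 0" if "1/2 \<le> \<bar>r\<bar>" for r using vanish that by (simp add: \<theta>_def)
  have q: "\<bar>q\<bar> \<le> 1/2" using of_int_round_abs_le[of p] by (simp add: q_def abs_minus_commute)
  have D: "(\<theta> has_real_derivative fl' \<bar>r\<bar> * \<bar>r\<bar> + fl \<bar>r\<bar>) (at r)" if "r \<noteq> 0" for r
    unfolding \<theta>_def using deriv that by (intro odd_force_has_derivative) auto
  \<comment> \<open>At absolute value 1/2 exactly, vanishing is known on the outer side only.
    \<open>D\<close> supplies a two-sided derivative, and the one-sided argument identifies its
    value as 0.\<close>
  have D0: "(\<theta> has_real_derivative 0) (at r)" if "1/2 \<le> \<bar>r\<bar>" for r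
    using D[of r] that vanish has_real_derivative_zero_of_vanishing[OF deriv, of "\<bar>r\<bar>"] by force
  have shift: "((\<lambda>t. \<theta> (c + t)) has_real_derivative E) (at 0)" if "(\<theta> has_real_derivative E) (at c)" for c E
    using that DERIV_shift[of \<theta> E 0 c] by (simp add: add.commute)
  have "((\<lambda>t. \<theta> (q + t) + \<theta> (q + 1 + t) + \<theta> (q - 1 + t))
      has_real_derivative (fl' \<bar>q\<bar> * \<bar>q\<bar> + fl \<bar>q\<bar>) + 0 + 0) (at 0)"
    by (intro DERIV_add shift D D0 \<open>q \<noteq> 0\<close>) (use q in auto)
  then have "((\<lambda>t. vector [\<theta> (q + t) + \<theta> (q + 1 + t) + \<theta> (q - 1 + t), 0] :: real^2)
      has_vector_derivative vector [fl' \<bar>q\<bar> * \<bar>q\<bar> + fl \<bar>q\<bar>, 0]) (at 0)"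
    by (intro has_vector_derivative_vector_2) auto
  then show "((\<lambda>t. periodic_force fl fs (vector [p, 0] + t *\<^sub>R axis 1 1))
      has_vector_derivative vector [fl' \<bar>q\<bar> * \<bar>q\<bar> + fl \<bar>q\<bar>, 0]) (at 0)"
  \<comment> \<open>This window for t keeps q + t within absolute value 1, as
    \<open>wrap_eq_sum\<close> requires.\<close>
  proof (rule has_vector_derivative_transform_within_open[of _ _ _ "{-1/2<..<1/2}"])
    fix t :: real assume t: "t \<in> {-1/2<..<1/2}"
    have 1: "vector [p, 0] + t *\<^sub>R axis 1 1 = (vector [p + t, 0] :: real^2)"
      by (simp add: vec_eq_iff forall_2 axis_def)
    have 2: "p + t - of_int (round (p + t)) = q + t - of_int (round (q + t))"
      using minus_round_add_int[of "q + t" "round p"] by (simp add: q_def algebra_simps)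
    have "periodic_force fl fs (vector [p, 0] + t *\<^sub>R axis 1 1) =
        vector [\<theta> (q + t - of_int (round (q + t))), 0]"
      unfolding 1 periodic_force_axis 2 \<theta>_def ..
    also have "\<theta> (q + t - of_int (round (q + t))) = \<theta> (q + t) + \<theta> (q + 1 + t) + \<theta> (q - 1 + t)"
      using wrap_eq_sum[of \<theta> "q + t", OF \<theta>0] q t by (auto simp: algebra_simps)
    finally show "vector [\<theta> (q + t) + \<theta> (q + 1 + t) + \<theta> (q - 1 + t), 0] =
        periodic_force fl fs (vector [p, 0] + t *\<^sub>R axis 1 1)" ..
  qed auto
qed

section \<open>Balance of forces on the line\<close>

lemma steady_state_horizontal_line:
  assumes vanish: "\<And>r. 1/2 \<le> r \<Longrightarrow> fl r = 0"
  shows "steady_state (periodic_force fl fs) N (horizontal_line N)"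
  unfolding steady_state_def
proof
  fix j assume j: "j \<in> {1..N}"
  then have N: "0 < N" by simp
  define \<theta> where "\<theta> r = fl \<bar>r\<bar> * r" for r
  have \<theta>0: "\<theta> r = 0" if "1/2 \<le> \<bar>r\<bar>" for r using vanish that by (simp add: \<theta>_def)
  have odd: "\<theta> (- r) = - \<theta> r" for r by (simp add: \<theta>_def)
  define g where "g i = \<theta> (- (of_int i / real N) - of_int (round (- (of_int i / real N))))" for i :: int
  \<comment> \<open>At -k/N the translate by -1 lies outside the cell. By oddness the force becomes
    a difference of \<open>\<theta>\<close> at the mirror points (N - k)/N and k/N.\<close>
  have gk: "g (int k) = \<theta> (real (N - k) / real N) - \<theta> (real k / real N)" if "k \<le> N" for k
  proof -
    have "g (int k) = \<theta> (- (real k / real N)) + \<theta> (- (real k / real N) + 1) + \<theta> (- (real k / real N) - 1)"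
      unfolding g_def of_int_of_nat_eq using that by (intro wrap_eq_sum \<theta>0) (auto simp: divide_simps)
    moreover have "0 \<le> real k / real N" by simp
    then have "\<theta> (- (real k / real N) - 1) = 0" by (intro \<theta>0) linarith
    moreover have "- (real k / real N) + 1 = real (N - k) / real N"
      using that N by (simp add: field_simps of_nat_diff)
    ultimately show ?thesis by (simp add: odd)
  qed
  have per: "g (i + int N) = g i" for i
  proof -
    have "- (of_int (i + int N) / real N) = - (of_int i / real N) + of_int (-1)"
      using N by (simp add: field_simps)
    then show ?thesis unfolding g_def by (simp only: minus_round_add_int)
  qed
  \<comment> \<open>The self-interaction \<open>k = j\<close> may be added, since
    \<open>\<theta> 0 = 0\<close>.\<close>
  have "(\<Sum>k\<in>{1..N} - {j}. g (int k - int j)) = (\<Sum>k=1..N. g (int k - int j))"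
    using j by (subst sum.remove[of _ j]) (auto simp: g_def \<theta>_def)
  also have "\<dots> = (\<Sum>k=1..N. g (int k))" by (rule sum_periodic_shift) (rule per)
  also have "\<dots> = (\<Sum>k=1..N. \<theta> (real (N - k) / real N)) - (\<Sum>k=1..N. \<theta> (real k / real N))"
    by (simp add: gk sum_subtractf)
  also have "(\<Sum>k=1..N. \<theta> (real (N - k) / real N)) = (\<Sum>k<N. \<theta> (real k / real N))"
    by (rule sum.reindex_bij_witness[of _ "\<lambda>k. N - k" "\<lambda>k. N - k"]) auto
  \<comment> \<open>Reflection has produced the indices 0 to N - 1, against 1 to N here. The
    mismatch is \<open>\<theta> 1 - \<theta> 0\<close>, and both values vanish.\<close>
  also have "(\<Sum>k=1..N. \<theta> (real k / real N)) = (\<Sum>k<N. \<theta> (real k / real N)) + (\<theta> 1 - \<theta> 0)"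
    using sum.atLeast1_atMost_eq[of "\<lambda>k. \<theta> (real k / real N)" N] N
      sum_lessThan_telescope[of "\<lambda>k. \<theta> (real k / real N)" N] by (simp add: sum_subtractf)
  also have "\<theta> 1 - \<theta> 0 = 0" using \<theta>0[of 1] by (simp add: \<theta>_def)
  finally have 0: "(\<Sum>k\<in>{1..N} - {j}. g (int k - int j)) = 0" by simp
  have "periodic_force fl fs (horizontal_line N j - horizontal_line N k) = vector [g (int k - int j), 0]" for k
  proof -
    have "- (of_int (int k - int j) / real N) = (real j - real k) / real N"
      by (simp add: diff_divide_distrib)
    then show ?thesis
      unfolding g_def horizontal_line_diff periodic_force_axis \<theta>_def by (simp only:)
  qed
  then show "(\<Sum>k\<in>{1..N} - {j}. periodic_force fl fs (horizontal_line N j - horizontal_line N k)) = 0"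
    using 0 by (simp add: vec_eq_iff forall_2)
qed

section \<open>The stability matrix of the line as a Riemann sum\<close>

text \<open>Entry \<open>(r, i)\<close> of the Jacobian of the force at a nonzero displacement \<open>(q, 0)\<close> within the unit
  cell, as a function of \<open>\<rho> = \<bar>q\<bar>\<close>; \<open>fl'\<close> stands for the derivative of \<open>fl\<close>.\<close>

definition line_profile ::
    "(real \<Rightarrow> real) \<Rightarrow> (real \<Rightarrow> real) \<Rightarrow> (real \<Rightarrow> real) \<Rightarrow> 2 \<Rightarrow> 2 \<Rightarrow> real \<Rightarrow> real" where
  "line_profile fl fl' fs r i \<rho> =
     (if r = 1 \<and> i = 1 then fl' \<rho> * \<rho> + fl \<rho> else if r = 2 \<and> i = 2 then fs \<rho> else 0)"

text \<open>On [0,1] the argument \<open>min s (1 - s)\<close> is the distance of s = k/N to the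
  nearest integer. The exponential prefactor vanishes at s = 0 and s = 1, so the particle itself
  contributes nothing.\<close>

definition line_kernel ::
    "(real \<Rightarrow> real) \<Rightarrow> (real \<Rightarrow> real) \<Rightarrow> (real \<Rightarrow> real) \<Rightarrow> nat \<Rightarrow> 2 \<Rightarrow> 2 \<Rightarrow> real \<Rightarrow> complex" where
  "line_kernel fl fl' fs m r i s =
     (1 - exp (2 * of_real pi * \<i> * of_nat m * of_real s))
       * of_real (line_profile fl fl' fs r i (min s (1 - s)))"

lemma Re_line_kernel:
  "Re (line_kernel fl fl' fs m r i s) =
    (1 - cos (2 * pi * real m * s)) * line_profile fl fl' fs r i (min s (1 - s))"
  by (simp add: line_kernel_def Re_exp)

lemma partial_deriv_periodic_force_axis:
  fixes p :: real
  defines "q \<equiv> p - of_int (round p)"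
  assumes fl: "\<And>r. 0 \<le> r \<Longrightarrow> (fl has_real_derivative fl' r) (at r within {0..})"
    and fs: "\<And>r. 0 \<le> r \<Longrightarrow> (fs has_real_derivative fs' r) (at r within {0..})"
    and vanish: "\<And>r. 1/2 \<le> r \<Longrightarrow> fl r = 0" and "q \<noteq> 0"
  shows "partial_deriv (periodic_force fl fs) i (vector [p, 0]) $ r = line_profile fl fl' fs r i \<bar>q\<bar>"
proof -
  have "\<forall>i r. partial_deriv (periodic_force fl fs) i (vector [p, 0]) $ r = line_profile fl fl' fs r i \<bar>q\<bar>"
    using partial_deriv_periodic_force_1[of fl fl' p, OF fl vanish, folded q_def]
      partial_deriv_periodic_force_2[of fl "fl' \<bar>q\<bar>" p fs "fs' \<bar>q\<bar>", folded q_def] fl fs \<open>q \<noteq> 0\<close>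
    by (simp add: forall_2 line_profile_def)
  then show ?thesis by blast
qed

text \<open>The omitted term \<open>k = j\<close> has zero prefactor and can be restored. The
  summand depends only on k - j and has period N, so \<open>sum_periodic_shift\<close> eliminates
  \<open>j\<close>.\<close>

lemma stability_matrix_horizontal_line:
  assumes fl: "\<And>r. 0 \<le> r \<Longrightarrow> (fl has_real_derivative fl' r) (at r within {0..})"
    and fs: "\<And>r. 0 \<le> r \<Longrightarrow> (fs has_real_derivative fs' r) (at r within {0..})"
    and vanish: "\<And>r. 1/2 \<le> r \<Longrightarrow> fl r = 0" and j: "j \<in> {1..N}"
  shows "stability_matrix (periodic_force fl fs) N (horizontal_line N) j m $ r $ i =
    (1 / real N) *\<^sub>R (\<Sum>k=1..N. line_kernel fl fl' fs m r i (real k / real N))"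
proof -
  have N: "0 < N" using j by simp
  define \<delta> where "\<delta> l = \<bar>- (of_int l / real N) - of_int (round (- (of_int l / real N)))\<bar>" for l :: int
  define g where "g l = (1 - exp (2 * of_real pi * \<i> * of_nat m * of_int l / of_nat N))
      * complex_of_real (line_profile fl fl' fs r i (\<delta> l))" for l :: int
  have per: "g (l + int N) = g l" for l
  proof -
    have "- (of_int (l + int N) / real N) = - (of_int l / real N) + of_int (-1)"
      using N by (simp add: field_simps)
    then have "\<delta> (l + int N) = \<delta> l" unfolding \<delta>_def by (simp only: minus_round_add_int)
    moreover have "2 * of_real pi * \<i> * of_nat m * of_int (l + int N) / of_nat N =
        2 * of_real pi * \<i> * of_nat m * of_int l / of_nat N + (2 * of_nat m * complex_of_real pi) * \<i>"
      using N by (simp add: field_simps)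
    moreover have "exp ((2 * of_nat m * complex_of_real pi) * \<i>) = 1"
      using exp_integer_2pi[of "real m"] by simp
    ultimately show ?thesis by (simp only: g_def exp_add mult_1_right)
  qed
  have summand: "(1 - exp (2 * of_real pi * \<i> * of_nat m * (of_nat k - of_nat j) / of_nat N))
        * of_real (partial_deriv (periodic_force fl fs) i (horizontal_line N j - horizontal_line N k) $ r)
      = g (int k - int j)" if k: "k \<in> {1..N} - {j}" for k
  proof -
    define p where "p = (real j - real k) / real N"
    have p: "p \<noteq> 0" "\<bar>p\<bar> < 1" using k j N by (auto simp: p_def field_simps abs_if)
    \<comment> \<open>Distinct particles differ by a non-integer displacement, so the derivative
      formulas, which exclude q = 0, apply.\<close>
    have "p - of_int (round p) \<noteq> 0"
    proof
      assume "p - of_int (round p) = 0"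
      then have "p = of_int (round p)" by simp
      with p have "round p \<noteq> 0" "\<bar>round p\<bar> < 1" by linarith+
      then show False by linarith
    qed
    moreover have "p = - (of_int (int k - int j) / real N)"
      by (simp add: p_def diff_divide_distrib)
    ultimately have "partial_deriv (periodic_force fl fs) i (vector [p, 0]) $ r = line_profile fl fl' fs r i (\<delta> (int k - int j))"
      unfolding \<delta>_def using partial_deriv_periodic_force_axis[of fl fl' fs fs' p i r, OF fl fs vanish] by simp
    then show ?thesis by (simp add: g_def horizontal_line_diff p_def)
  qed
  have gk: "g (int k) = line_kernel fl fl' fs m r i (real k / real N)" if "k \<in> {1..N}" for k
  proof -
    have "\<delta> (int k) = min (real k / real N) (1 - real k / real N)"
      unfolding \<delta>_def of_int_of_nat_eq using that by (intro abs_minus_round_uminus) auto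
    then show ?thesis by (simp add: g_def line_kernel_def)
  qed
  have "(\<Sum>k\<in>{1..N} - {j}. g (int k - int j)) = (\<Sum>k=1..N. g (int k - int j))"
    using j by (subst sum.remove[of _ j]) (auto simp: g_def)
  also have "\<dots> = (\<Sum>k=1..N. g (int k))" by (rule sum_periodic_shift) (rule per)
  also have "\<dots> = (\<Sum>k=1..N. line_kernel fl fl' fs m r i (real k / real N))"
    by (rule sum.cong) (use gk in auto)
  finally have "(\<Sum>k\<in>{1..N} - {j}. g (int k - int j)) = \<dots>" .
  moreover have "stability_matrix (periodic_force fl fs) N (horizontal_line N) j m $ r $ i =
      (1 / of_nat N) * (\<Sum>k\<in>{1..N} - {j}. g (int k - int j))"
    unfolding stability_matrix_def stability_column_def using summand by simp
  ultimately show ?thesis by (simp add: scaleR_conv_of_real)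
qed

text \<open>The second coordinate vector spans an invariant line, so \<open>A $ 2 $ 2\<close> is an
  eigenvalue. For the horizontal line this is a perturbation perpendicular to it.\<close>

lemma has_unstable_eigenvalue_lower_triangular:
  fixes A :: "complex^2^2"
  assumes "A $ 1 $ 2 = 0" "0 < Re (A $ 2 $ 2)"
  shows "has_unstable_eigenvalue A"
proof -
  have "A *v axis 2 1 = A $ 2 $ 2 *s axis 2 1"
    using assms(1) by (simp add: vec_eq_iff forall_2 matrix_vector_mult_def sum_2 axis_def)
  moreover have "axis 2 (1::complex) \<noteq> (0 :: complex^2)" by (simp add: axis_eq_0_iff)
  ultimately show ?thesis using assms(2) unfolding has_unstable_eigenvalue_def eigenvalue_def by blast
qed

text \<open>Since \<open>min s (1 - s)\<close> maps [0,1] into \<open>{0..}\<close>, continuity of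
  \<open>fl\<close>, \<open>fl'\<close> and \<open>fs\<close> up to distance 0 carries over to the
  closed interval, endpoints included, as \<open>riemann_sum_tendsto_integral\<close> needs.\<close>

lemma continuous_on_line_kernel:
  assumes fl: "continuous_on {0..} fl" and fl': "continuous_on {0..} fl'" and fs: "continuous_on {0..} fs"
  shows "continuous_on {0..1} (line_kernel fl fl' fs m r i)"
proof -
  have "continuous_on {0..} (line_profile fl fl' fs r i)"
    unfolding line_profile_def using assms exhaust_2[of r] exhaust_2[of i]
    by (auto intro!: continuous_intros)
  then have "continuous_on {0..1} (\<lambda>s. line_profile fl fl' fs r i (min s (1 - s)))"
    by (rule continuous_on_compose2) (auto intro!: continuous_intros)
  then show ?thesis unfolding line_kernel_def by (intro continuous_intros)
qed

section \<open>Instability of the line\<close>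

theorem theorem3p8:
  fixes Rc :: real and fl fs :: "real \<Rightarrow> real"
  assumes "0 < Rc" and "Rc \<le> 1/2"
    and "force_coefficients Rc fl fs"
    and "\<forall>r. 0 \<le> r \<and> r < Rc \<longrightarrow> 0 < fs r"
  shows "(\<forall>N\<ge>1. steady_state (periodic_force fl fs) N (horizontal_line N))
       \<and> unstable_for_large_N (periodic_force fl fs) horizontal_line
       \<and> unstable_in_continuum_limit (periodic_force fl fs) horizontal_line"
proof (intro conjI allI impI)
  obtain fl' fs' where fl: "\<And>r. 0 \<le> r \<Longrightarrow> (fl has_real_derivative fl' r) (at r within {0..})"
    and fs: "\<And>r. 0 \<le> r \<Longrightarrow> (fs has_real_derivative fs' r) (at r within {0..})"
    and fl'_cont: "continuous_on {0..} fl'"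
    using assms(3) unfolding force_coefficients_def C1_on_nonneg_def by blast
  have vanish: "fl r = 0" if "1/2 \<le> r" for r
    using assms(2,3) that unfolding force_coefficients_def by simp
  have fs_nonneg: "0 \<le> fs r" if "0 \<le> r" for r
    using assms(3) that unfolding force_coefficients_def by simp
  let ?h = "line_kernel fl fl' fs"
  have entry: "stability_matrix (periodic_force fl fs) N (horizontal_line N) j m $ r $ i =
      (1 / real N) *\<^sub>R (\<Sum>k=1..N. ?h m r i (real k / real N))" if "j \<in> {1..N}" for N j m r i
    using fl fs vanish that by (rule stability_matrix_horizontal_line)
  have h12: "?h m 1 2 = (\<lambda>_. 0)" for m by (rule ext) (simp add: line_kernel_def line_profile_def)
  have Re_h22: "Re (?h 1 2 2 s) = (1 - cos (2 * pi * s)) * fs (min s (1 - s))" for s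
    by (simp add: Re_line_kernel line_profile_def)
  have h22_nonneg: "0 \<le> Re (?h 1 2 2 s)" if "s \<in> {0..1}" for s
    unfolding Re_h22 using that by (intro mult_nonneg_nonneg fs_nonneg) auto
  have h22_pos: "0 < Re (?h 1 2 2 s)" if "0 < s" "s < Rc" for s
  proof -
    \<comment> \<open>By s < Rc \<le> 1/2 the angle lies strictly between 0 and pi, where cosine is
      strictly decreasing.\<close>
    have "cos (2 * pi * s) < 1"
      using that assms(2) cos_monotone_0_pi[of 0 "2 * pi * s"] by simp
    moreover have "min s (1 - s) = s" using that assms(2) by simp
    ultimately show ?thesis unfolding Re_h22 using that assms(4) by simp
  qed
  show "steady_state (periodic_force fl fs) N (horizontal_line N)" for N
    by (rule steady_state_horizontal_line) (rule vanish)

  \<comment> \<open>Beyond 1/Rc the first grid point 1/N lies within the cutoff, so the term k = 1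
    is strictly positive. The bound 2 makes the frequency m = 1 admissible.\<close>
  obtain N0 :: nat where N0: "1 / Rc < real N0" using reals_Archimedean2 by blast
  show "unstable_for_large_N (periodic_force fl fs) horizontal_line"
    unfolding unstable_for_large_N_def
  proof (intro exI[of _ "max 2 N0"] allI impI bexI[of _ 1] ballI)
    fix N assume N: "max 2 N0 \<le> N"
    then show "1 \<in> {1..<N}" by simp
    fix j assume j: "j \<in> {1..N}"
    let ?A = "stability_matrix (periodic_force fl fs) N (horizontal_line N) j 1"
    have A12: "?A $ 1 $ 2 = 0" unfolding entry[OF j] by (simp add: h12)
    have "1 / Rc < real N" using N0 N by linarith
    then have "1 / real N < Rc" using assms(1) N by (simp add: field_simps)
    then have "0 < (\<Sum>k=1..N. Re (?h 1 2 2 (real k / real N)))"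
      using N by (intro sum_pos2[of _ 1] h22_pos h22_nonneg) auto
    then have "0 < Re (?A $ 2 $ 2)" unfolding entry[OF j] using N by simp
    with A12 show "has_unstable_eigenvalue ?A" by (rule has_unstable_eigenvalue_lower_triangular)
  qed

  have cont: "continuous_on {0..1} (?h m r i)" for m r i
    using fl fs by (intro continuous_on_line_kernel fl'_cont DERIV_continuous_on[of _ fl fl'] DERIV_continuous_on[of _ fs fs']) auto
  define M :: "nat \<Rightarrow> complex^2^2" where "M m = (\<chi> r i. integral {0..1} (?h m r i))" for m
  have "(\<lambda>N. stability_matrix (periodic_force fl fs) N (horizontal_line N) j m) \<longlonglongrightarrow> M m" if "1 \<le> j" for m j
  proof (intro vec_tendstoI)
    fix r i
    \<comment> \<open>The entry formula holds only once particle \<open>j\<close> exists, that is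
      for N \<ge> j.\<close>
    have "\<forall>\<^sub>F N in sequentially. (1 / real N) *\<^sub>R (\<Sum>k=1..N. ?h m r i (real k / real N))
        = stability_matrix (periodic_force fl fs) N (horizontal_line N) j m $ r $ i"
      using eventually_ge_at_top[of j] by eventually_elim (use that entry in simp)
    from Lim_transform_eventually[OF riemann_sum_tendsto_integral[OF cont] this]
    show "(\<lambda>N. stability_matrix (periodic_force fl fs) N (horizontal_line N) j m $ r $ i) \<longlonglongrightarrow> M m $ r $ i"
      by (simp add: M_def)
  qed
  moreover have "has_unstable_eigenvalue (M 1)"
  proof (rule has_unstable_eigenvalue_lower_triangular)
    show "M 1 $ 1 $ 2 = 0" by (simp add: M_def h12)
    have contRe: "continuous_on {0..1} (\<lambda>s. Re (?h 1 2 2 s))" by (intro continuous_on_Re cont)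
    \<comment> \<open>A nonnegative continuous function with zero integral vanishes identically,
      which the point Rc/2 refutes.\<close>
    have "Re (?h 1 2 2 (Rc / 2)) \<noteq> 0" using h22_pos[of "Rc / 2"] assms(1) by simp
    moreover have "Rc / 2 \<in> {0..1}" using assms(1,2) by simp
    ultimately have "integral {0..1} (\<lambda>s. Re (?h 1 2 2 s)) \<noteq> 0"
      using integral_eq_0_iff[OF contRe zero_less_one h22_nonneg] by blast
    moreover have "0 \<le> integral {0..1} (\<lambda>s. Re (?h 1 2 2 s))"
      by (intro integral_nonneg integrable_continuous_interval contRe h22_nonneg)
    moreover have "integral {0..1} (\<lambda>s. Re (?h 1 2 2 s)) = Re (M 1 $ 2 $ 2)"
      using integral_linear[OF integrable_continuous_interval[OF cont] bounded_linear_Re, of 1 2 2]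
      by (simp add: M_def o_def)
    ultimately show "0 < Re (M 1 $ 2 $ 2)" by simp
  qed
  ultimately show "unstable_in_continuum_limit (periodic_force fl fs) horizontal_line"
    unfolding unstable_in_continuum_limit_def by blast
qed

end
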